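(* Let $P=(P,\sqsubseteq)$ be a poset. Then $\mathscr A(P)$ is a lattice if and only if for all $A,B\in\mathscr A(P)$ there is $C\in\mathscr A(P)$ with $\downarrow A\cap\downarrow B=\downarrow C$; in that case $A\wedge B=C$, and moreover $\mathscr A(P)$ is distributive. In particular, if $P$ is a $\sqcap$-semilattice and $\mathscr A(P)$ is a lattice, then the meet of $A,B\in\mathscr A(P)$ is the set of maximal elements of $\{a\sqcap b: a\in A, b\in B\}$.
   Context: For $X\subseteq P$, $\downarrow X=\{y\in P:\exists x\in X,\ y\sqsubseteq x\}$. $\mathscr A(P)$ is the set of antichains of $P$ ordered by $A\le B$ iff $\downarrow A\subseteq\downarrow B$. *)

theory Defs
  imports "HOL-Algebra.Lattice"
begin

definition down :: "('a, 'b) gorder_scheme \<Rightarrow> 'a set \<Rightarrow> 'a set" where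
  "down P X = {y \<in> carrier P. \<exists>x\<in>X. y \<sqsubseteq>\<^bsub>P\<^esub> x}"

definition antichains :: "('a, 'b) gorder_scheme \<Rightarrow> 'a set set" where
  "antichains P = {A. A \<subseteq> carrier P \<and> (\<forall>x\<in>A. \<forall>y\<in>A. x \<sqsubseteq>\<^bsub>P\<^esub> y \<longrightarrow> x = y)}"

text \<open>The empty antichain and infinite antichains are included.\<close>

definition antichain_order :: "('a, 'b) gorder_scheme \<Rightarrow> 'a set gorder" where
  "antichain_order P =
     \<lparr>carrier = antichains P, eq = (=), le = (\<lambda>A B. down P A \<subseteq> down P B)\<rparr>"

definition maximal_elements :: "('a, 'b) gorder_scheme \<Rightarrow> 'a set \<Rightarrow> 'a set" where
  "maximal_elements P X = {x \<in> X. \<forall>y\<in>X. x \<sqsubseteq>\<^bsub>P\<^esub> y \<longrightarrow> y = x}"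

locale distributive_lattice = lattice +
  assumes meet_join_distrib:
    "\<lbrakk>x \<in> carrier L; y \<in> carrier L; z \<in> carrier L\<rbrakk>
      \<Longrightarrow> x \<sqinter> (y \<squnion> z) = (x \<sqinter> y) \<squnion> (x \<sqinter> z)"

end

theory Submission
  imports Defs
begin

text \<open>
  The map \<open>A \<mapsto> \<down>A\<close> embeds the antichains into the lower sets. The union of two lower sets
  \<open>\<down>A\<close> and \<open>\<down>B\<close> is again generated by an antichain, so binary joins always exist and are unions.
  Since every singleton is an antichain, an infimum of two antichains must capture every point
  of \<open>\<down>A \<inter> \<down>B\<close>, so binary meets can only be intersections; distributivity is inherited from
  that of sets.
\<close>

section \<open>Lower sets and the order they induce on antichains\<close>

lemma down_Un: "down P (A \<union> B) = down P A \<union> down P B"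
  by (auto simp: down_def)

lemma antichains_subset_carrier: "A \<in> antichains P \<Longrightarrow> A \<subseteq> carrier P"
  by (simp add: antichains_def)

lemma antichains_eqI:
  "\<lbrakk>A \<in> antichains P; x \<in> A; y \<in> A; x \<sqsubseteq>\<^bsub>P\<^esub> y\<rbrakk> \<Longrightarrow> x = y"
  by (simp add: antichains_def)

lemma carrier_antichain_order [simp]: "carrier (antichain_order P) = antichains P"
  and eq_antichain_order [simp]: "eq (antichain_order P) = (=)"
  and le_antichain_order [simp]: "le (antichain_order P) A B \<longleftrightarrow> down P A \<subseteq> down P B"
  by (simp_all add: antichain_order_def)

context partial_order
begin

lemma subset_down: "A \<subseteq> carrier L \<Longrightarrow> A \<subseteq> down L A"
  unfolding down_def by blast

text \<open>By transitivity \<open>down L B\<close> is closed downwards, so an inclusion of lower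
  sets only has to be tested on generators.\<close>

lemma down_subset_iff:
  assumes "A \<subseteq> carrier L" "B \<subseteq> carrier L"
  shows "down L A \<subseteq> down L B \<longleftrightarrow> A \<subseteq> down L B"
proof
  show "down L A \<subseteq> down L B \<Longrightarrow> A \<subseteq> down L B"
    using subset_down[OF assms(1)] by blast
  show "down L A \<subseteq> down L B" if sub: "A \<subseteq> down L B"
  proof
    fix x assume "x \<in> down L A"
    then obtain a where x: "x \<in> carrier L" "a \<in> A" "x \<sqsubseteq> a" by (auto simp: down_def)
    moreover obtain b where b: "b \<in> B" "a \<sqsubseteq> b" using sub x by (auto simp: down_def)
    ultimately have "x \<sqsubseteq> b" using assms le_trans[of x a b] by blast
    with x b show "x \<in> down L B" by (auto simp: down_def)
  qed
qed

lemma singleton_antichain: "x \<in> carrier L \<Longrightarrow> {x} \<in> antichains L"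
  by (simp add: antichains_def)

section \<open>Recovering an antichain from its lower set\<close>

text \<open>Transitivity makes \<open>c\<close> and \<open>d\<close> comparable, hence equal, and
  antisymmetry then collapses the interval between them. This is the sandwich argument behind the
  identification of maximal elements below.\<close>

lemma antichain_between_eq:
  assumes C: "C \<in> antichains L" and cd: "c \<in> C" "d \<in> C"
    and x: "x \<in> carrier L" "c \<sqsubseteq> x" "x \<sqsubseteq> d"
  shows "x = c"
proof -
  have carr: "c \<in> carrier L" "d \<in> carrier L"
    using cd antichains_subset_carrier[OF C] by auto
  then have "c \<sqsubseteq> d" using le_trans[OF x(2,3)] x(1) by simp
  then have "c = d" using antichains_eqI[OF C cd] by simp
  then show ?thesis using le_antisym[OF x(3)] x carr by simp
qed

text \<open>Equal lower sets put each \<open>c\<close> in \<open>C\<close> below some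
  \<open>x\<close> in \<open>X\<close>, and that \<open>x\<close> below some \<open>d\<close> in
  \<open>C\<close>. The sandwich forces \<open>x = c\<close>, so \<open>C\<close> lies in
  \<open>X\<close> and nothing in \<open>X\<close> is strictly above it. The lemma serves both the
  injectivity of \<open>down\<close> on antichains and the formula for meets in a
  semilattice.\<close>

lemma maximal_elements_eq_if_down_eq:
  assumes C: "C \<in> antichains L" and X: "X \<subseteq> carrier L" and eq: "down L C = down L X"
  shows "maximal_elements L X = C"
proof -
  have CC: "C \<subseteq> carrier L" using C by (rule antichains_subset_carrier)
  have X_C: "\<exists>c\<in>C. x \<sqsubseteq> c" if "x \<in> X" for x
    using subsetD[OF subset_down[OF X] that] unfolding eq[symmetric] by (simp add: down_def)
  have C_X: "c \<in> X" if c: "c \<in> C" for c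
  proof -
    obtain x where x: "x \<in> X" "c \<sqsubseteq> x"
      using subsetD[OF subset_down[OF CC] c] unfolding eq by (auto simp: down_def)
    obtain d where d: "d \<in> C" "x \<sqsubseteq> d" using X_C x by blast
    have "x = c" using antichain_between_eq[OF C c d(1) _ x(2) d(2)] x X by blast
    then show ?thesis using x by simp
  qed
  show ?thesis
  proof
    show "maximal_elements L X \<subseteq> C"
    proof
      fix x assume x: "x \<in> maximal_elements L X"
      then obtain c where c: "c \<in> C" "x \<sqsubseteq> c"
        using X_C[of x] by (auto simp: maximal_elements_def)
      \<comment> \<open>Since \<open>C\<close> lies in \<open>X\<close>, the bound \<open>c\<close>
        competes with \<open>x\<close> inside \<open>X\<close>, and maximality of \<open>x\<close>
        applies.\<close>
      then have "c = x" using x C_X by (simp add: maximal_elements_def)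
      then show "x \<in> C" using c by simp
    qed
    show "C \<subseteq> maximal_elements L X"
    proof
      fix c assume c: "c \<in> C"
      have "x = c" if x: "x \<in> X" "c \<sqsubseteq> x" for x
      proof -
        obtain d where d: "d \<in> C" "x \<sqsubseteq> d" using X_C x by blast
        show ?thesis using antichain_between_eq[OF C c d(1) _ x(2) d(2)] x X by blast
      qed
      then show "c \<in> maximal_elements L X"
        using C_X[OF c] by (auto simp: maximal_elements_def)
    qed
  qed
qed

lemma maximal_elements_of_antichain: "A \<in> antichains L \<Longrightarrow> maximal_elements L A = A"
  by (auto simp: maximal_elements_def antichains_def)

text \<open>Both antichains are the set of maximal elements of \<open>B\<close>. As the order on
  antichains carries genuine equality, this is exactly its antisymmetry.\<close>

lemma down_inj:
  assumes "A \<in> antichains L" "B \<in> antichains L" "down L A = down L B"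
  shows "A = B"
  using maximal_elements_eq_if_down_eq[OF assms(1) antichains_subset_carrier[OF assms(2)] assms(3)]
    maximal_elements_of_antichain[OF assms(2)] by simp

lemma antichain_order_partial_order: "partial_order (antichain_order L)"
  by unfold_locales (simp_all add: down_inj)

section \<open>Joins of antichains\<close>

lemma maximal_elements_antichain:
  "X \<subseteq> carrier L \<Longrightarrow> maximal_elements L X \<in> antichains L"
  by (auto simp: maximal_elements_def antichains_def)

text \<open>
  A chain in \<open>A \<union> B\<close> has at most two elements, so every element of the union lies below a
  maximal one.
\<close>

lemma down_maximal_elements_Un:
  assumes A: "A \<in> antichains L" and B: "B \<in> antichains L"
  shows "down L (maximal_elements L (A \<union> B)) = down L A \<union> down L B"
proof -
  \<comment> \<open>Stated for arbitrary \<open>A'\<close> and \<open>B'\<close> because it is used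
    twice, with the two antichains exchanged.\<close>
  have below: "\<exists>m\<in>maximal_elements L (A' \<union> B'). x \<sqsubseteq> m"
    if A': "A' \<in> antichains L" and B': "B' \<in> antichains L" and x: "x \<in> A'" for A' B' x
  proof (cases "\<exists>y\<in>B'. x \<sqsubseteq> y")
    case True
    then obtain y where y: "y \<in> B'" "x \<sqsubseteq> y" by blast
    \<comment> \<open>The element \<open>y\<close> above \<open>x\<close> is already maximal in the
      union: a further \<open>z\<close> in \<open>B'\<close> is comparable to \<open>y\<close>,
      while a \<open>z\<close> in \<open>A'\<close> squeezes \<open>y\<close> between the elements
      \<open>x\<close> and \<open>z\<close> of the antichain \<open>A'\<close>.\<close>
    have "z = y" if z: "z \<in> A' \<union> B'" "y \<sqsubseteq> z" for z
    proof (cases "z \<in> B'")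
      case True
      then show ?thesis using antichains_eqI[OF B' y(1) _ z(2)] by simp
    next
      case False
      then have "z \<in> A'" using z by simp
      moreover have "y \<in> carrier L" "z \<in> carrier L"
        using y z A' B' by (auto dest: antichains_subset_carrier)
      ultimately have "y = x"
        using antichain_between_eq[OF A' x _ _ y(2) z(2)] by simp
      moreover from this have "x = z"
        using antichains_eqI[OF A' x \<open>z \<in> A'\<close>] z(2) by simp
      ultimately show ?thesis by simp
    qed
    then show ?thesis using y by (auto simp: maximal_elements_def)
  next
    case False
    \<comment> \<open>Nothing in \<open>B'\<close> is above \<open>x\<close>, and in
      \<open>A'\<close> only \<open>x\<close> itself is, so \<open>x\<close> is its own maximal
      bound.\<close>
    then have "x \<in> maximal_elements L (A' \<union> B')"
      using antichains_eqI[OF A' x, symmetric] x unfolding maximal_elements_def by blast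
    moreover have "x \<in> carrier L"
      using x A' by (auto dest: antichains_subset_carrier)
    ultimately show ?thesis by blast
  qed
  have AB: "A \<union> B \<subseteq> carrier L"
    using A B by (auto dest: antichains_subset_carrier)
  then have M: "maximal_elements L (A \<union> B) \<subseteq> carrier L"
    by (auto simp: maximal_elements_def)
  have "\<exists>m\<in>maximal_elements L (A \<union> B). x \<sqsubseteq> m" if "x \<in> A \<union> B" for x
    using that below[OF A B] below[OF B A] by (auto simp: Un_commute)
  then have "A \<union> B \<subseteq> down L (maximal_elements L (A \<union> B))"
    using AB by (auto simp: down_def)
  then have "down L (A \<union> B) \<subseteq> down L (maximal_elements L (A \<union> B))"
    using down_subset_iff[OF AB M] by simp
  moreover have "down L (maximal_elements L (A \<union> B)) \<subseteq> down L (A \<union> B)"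
    by (auto simp: down_def maximal_elements_def)
  ultimately show ?thesis unfolding down_Un by blast
qed

lemma antichain_join_exists:
  assumes "A \<in> antichains L" "B \<in> antichains L"
  obtains C where "C \<in> antichains L" "down L C = down L A \<union> down L B"
proof
  show "maximal_elements L (A \<union> B) \<in> antichains L"
    using assms by (intro maximal_elements_antichain) (auto dest: antichains_subset_carrier)
  show "down L (maximal_elements L (A \<union> B)) = down L A \<union> down L B"
    by (rule down_maximal_elements_Un[OF assms])
qed

section \<open>Infima and suprema as intersections and unions\<close>

text \<open>The singletons of points in the intersection serve as test lower bounds. Phrasing this
  with \<open>greatest\<close> avoids the choice operator behind \<open>\<sqinter>\<close>, which
  says nothing before existence is known.\<close>

lemma greatest_Lower_antichain_iff:
  assumes A: "A \<in> antichains L" and B: "B \<in> antichains L"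
  shows "greatest (antichain_order L) C (Lower (antichain_order L) {A, B})
    \<longleftrightarrow> C \<in> antichains L \<and> down L C = down L A \<inter> down L B" (is "?g \<longleftrightarrow> ?d")
proof
  assume g: ?g
  then have C: "C \<in> antichains L" by (auto dest: greatest_closed)
  have lower: "down L C \<subseteq> down L A \<inter> down L B"
    using g A B by (auto simp: greatest_def Lower_def)
  have "x \<in> down L C" if x: "x \<in> down L A \<inter> down L B" for x
  proof -
    have xc: "x \<in> carrier L" using x by (simp add: down_def)
    have AC: "A \<subseteq> carrier L" and BC: "B \<subseteq> carrier L"
      using A B by (auto dest: antichains_subset_carrier)
    have "down L {x} \<subseteq> down L A" "down L {x} \<subseteq> down L B"
      using x xc AC BC by (simp_all add: down_subset_iff)
    then have "{x} \<in> Lower (antichain_order L) {A, B}"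
      using singleton_antichain[OF xc] by (auto simp: Lower_def)
    then have "down L {x} \<subseteq> down L C"
      using g by (auto simp: greatest_def)
    then show ?thesis using xc subset_down[of "{x}"] by auto
  qed
  with C lower show ?d by blast
next
  assume ?d
  then show ?g using A B by (auto simp: greatest_def Lower_def)
qed

text \<open>Here the test object is the antichain \<open>J\<close> generating the union: it is an
  upper bound, so a least one cannot have a larger lower set.\<close>

lemma least_Upper_antichain_iff:
  assumes A: "A \<in> antichains L" and B: "B \<in> antichains L"
  shows "least (antichain_order L) C (Upper (antichain_order L) {A, B})
    \<longleftrightarrow> C \<in> antichains L \<and> down L C = down L A \<union> down L B" (is "?l \<longleftrightarrow> ?d")
proof
  assume l: ?l
  obtain J where J: "J \<in> antichains L" "down L J = down L A \<union> down L B"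
    using antichain_join_exists[OF A B] .
  then have "J \<in> Upper (antichain_order L) {A, B}"
    by (auto simp: Upper_def)
  then have "down L C \<subseteq> down L J"
    using l by (simp add: least_def)
  moreover have "C \<in> antichains L" "down L A \<subseteq> down L C" "down L B \<subseteq> down L C"
    using l A B by (simp_all add: least_def Upper_def)
  ultimately show ?d using J by blast
next
  assume ?d
  then show ?l using A B by (auto simp: least_def Upper_def)
qed

lemma antichain_lattice_iff:
  "lattice (antichain_order L) \<longleftrightarrow>
    (\<forall>A\<in>antichains L. \<forall>B\<in>antichains L. \<exists>C\<in>antichains L. down L A \<inter> down L B = down L C)"
  (is "?lat \<longleftrightarrow> ?meets")
proof
  assume ?lat
  then interpret A: lattice "antichain_order L" .
  show ?meets
  proof (intro ballI)
    fix A B assume A: "A \<in> antichains L" and B: "B \<in> antichains L"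
    then obtain C where "greatest (antichain_order L) C (Lower (antichain_order L) {A, B})"
      using A.inf_of_two_exists by auto
    then show "\<exists>C\<in>antichains L. down L A \<inter> down L B = down L C"
      unfolding greatest_Lower_antichain_iff[OF A B] by auto
  qed
next
  assume meets: ?meets
  \<comment> \<open>With the order axioms in place, only the existence of binary suprema and infima
    is left. Suprema exist unconditionally; infima come from the hypothesis.\<close>
  interpret A: partial_order "antichain_order L"
    by (rule antichain_order_partial_order)
  show ?lat
  proof
    fix A B
    assume "A \<in> carrier (antichain_order L)" "B \<in> carrier (antichain_order L)"
    then have A: "A \<in> antichains L" and B: "B \<in> antichains L" by simp_all
    show "\<exists>s. least (antichain_order L) s (Upper (antichain_order L) {A, B})"
      using antichain_join_exists[OF A B] by (metis least_Upper_antichain_iff[OF A B])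
    show "\<exists>s. greatest (antichain_order L) s (Lower (antichain_order L) {A, B})"
      using meets A B by (metis greatest_Lower_antichain_iff[OF A B])
  qed
qed

section \<open>Lattice operations and distributivity\<close>

context
  assumes lattice: "lattice (antichain_order L)"
begin

interpretation A: lattice "antichain_order L" by (rule lattice)

text \<open>In a lattice the chosen element really is an infimum, so the characterisation by
  intersections applies to it.\<close>

lemma antichain_meet:
  assumes "A \<in> antichains L" "B \<in> antichains L"
  shows "A \<sqinter>\<^bsub>antichain_order L\<^esub> B \<in> antichains L"
    and "down L (A \<sqinter>\<^bsub>antichain_order L\<^esub> B) = down L A \<inter> down L B"
  using A.inf_of_two_greatest[of A B] assms
  by (simp_all add: greatest_Lower_antichain_iff meet_def)

lemma antichain_join:
  assumes "A \<in> antichains L" "B \<in> antichains L"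
  shows "A \<squnion>\<^bsub>antichain_order L\<^esub> B \<in> antichains L"
    and "down L (A \<squnion>\<^bsub>antichain_order L\<^esub> B) = down L A \<union> down L B"
  using A.sup_of_two_least[of A B] assms
  by (simp_all add: least_Upper_antichain_iff join_def)

lemma antichain_meet_eqI:
  assumes "A \<in> antichains L" "B \<in> antichains L" "C \<in> antichains L"
    and "down L A \<inter> down L B = down L C"
  shows "A \<sqinter>\<^bsub>antichain_order L\<^esub> B = C"
  using assms by (simp add: down_inj antichain_meet)

lemma antichain_distributive_lattice: "distributive_lattice (antichain_order L)"
proof
  fix A B C
  assume "A \<in> carrier (antichain_order L)" "B \<in> carrier (antichain_order L)"
    "C \<in> carrier (antichain_order L)"
  then show "A \<sqinter>\<^bsub>antichain_order L\<^esub> (B \<squnion>\<^bsub>antichain_order L\<^esub> C) =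
      (A \<sqinter>\<^bsub>antichain_order L\<^esub> B) \<squnion>\<^bsub>antichain_order L\<^esub> (A \<sqinter>\<^bsub>antichain_order L\<^esub> C)"
    \<comment> \<open>Injectivity of \<open>down\<close> reduces the equation to lower sets, where
      it becomes \<open>Int_Un_distrib\<close>.\<close>
    by (simp add: down_inj antichain_meet antichain_join Int_Un_distrib)
qed

end

end

section \<open>Antichains in a meet-semilattice\<close>

text \<open>This is the universal property of \<open>a \<sqinter> b\<close>, taken over all pairs.
  The pairwise meets need not form an antichain, so they generate the right lower set without yet
  being the meet.\<close>

lemma (in lower_semilattice) down_meets:
  assumes "A \<subseteq> carrier L" "B \<subseteq> carrier L"
  shows "down L {a \<sqinter> b | a b. a \<in> A \<and> b \<in> B} = down L A \<inter> down L B"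
proof
  show "down L {a \<sqinter> b | a b. a \<in> A \<and> b \<in> B} \<subseteq> down L A \<inter> down L B"
  proof
    fix x assume "x \<in> down L {a \<sqinter> b | a b. a \<in> A \<and> b \<in> B}"
    then obtain a b where x: "x \<in> carrier L" "a \<in> A" "b \<in> B" "x \<sqsubseteq> a \<sqinter> b"
      by (auto simp: down_def)
    then have "a \<in> carrier L" "b \<in> carrier L" using assms by auto
    then have "x \<sqsubseteq> a" "x \<sqsubseteq> b"
      using x le_trans[OF x(4) meet_left] le_trans[OF x(4) meet_right] by simp_all
    then show "x \<in> down L A \<inter> down L B" using x by (auto simp: down_def)
  qed
  show "down L A \<inter> down L B \<subseteq> down L {a \<sqinter> b | a b. a \<in> A \<and> b \<in> B}"
  proof
    fix x assume "x \<in> down L A \<inter> down L B"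
    then obtain a b where x: "x \<in> carrier L" "a \<in> A" "b \<in> B" "x \<sqsubseteq> a" "x \<sqsubseteq> b"
      by (auto simp: down_def)
    then have "x \<sqsubseteq> a \<sqinter> b" using assms by (intro meet_le) auto
    then show "x \<in> down L {a \<sqinter> b | a b. a \<in> A \<and> b \<in> B}"
      using x by (auto simp: down_def)
  qed
qed

text \<open>The meet is an antichain with the same lower set as the pairwise meets, hence consists
  of their maximal elements. The lattice hypothesis supplies this antichain, and with it enough
  maximal elements; no chain condition on the poset is involved.\<close>

lemma (in lower_semilattice) antichain_meet_eq_maximal_elements:
  assumes lat: "lattice (antichain_order L)"
    and A: "A \<in> antichains L" and B: "B \<in> antichains L"
  shows "A \<sqinter>\<^bsub>antichain_order L\<^esub> B = maximal_elements L {a \<sqinter> b | a b. a \<in> A \<and> b \<in> B}"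
proof -
  have AC: "A \<subseteq> carrier L" and BC: "B \<subseteq> carrier L"
    using A B by (auto dest: antichains_subset_carrier)
  then have "{a \<sqinter> b | a b. a \<in> A \<and> b \<in> B} \<subseteq> carrier L"
    by (auto intro!: meet_closed)
  then show ?thesis
    using antichain_meet[OF lat A B] down_meets[OF AC BC] maximal_elements_eq_if_down_eq by simp
qed

theorem theorem3:
  fixes P :: "('a, 'b) gorder_scheme"
  assumes "partial_order P"
  shows
    "(lattice (antichain_order P) \<longleftrightarrow>
        (\<forall>A\<in>antichains P. \<forall>B\<in>antichains P. \<exists>C\<in>antichains P.
           down P A \<inter> down P B = down P C))
     \<and> (lattice (antichain_order P) \<longrightarrow>
          (\<forall>A\<in>antichains P. \<forall>B\<in>antichains P. \<forall>C\<in>antichains P.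
             down P A \<inter> down P B = down P C \<longrightarrow> A \<sqinter>\<^bsub>antichain_order P\<^esub> B = C)
          \<and> distributive_lattice (antichain_order P))
     \<and> (lower_semilattice P \<and> lattice (antichain_order P) \<longrightarrow>
          (\<forall>A\<in>antichains P. \<forall>B\<in>antichains P.
             A \<sqinter>\<^bsub>antichain_order P\<^esub> B
               = maximal_elements P {a \<sqinter>\<^bsub>P\<^esub> b | a b. a \<in> A \<and> b \<in> B}))"
proof -
  interpret partial_order P by (rule assms)
  show ?thesis
  proof (intro conjI impI ballI)
    show "lattice (antichain_order P) \<longleftrightarrow>
      (\<forall>A\<in>antichains P. \<forall>B\<in>antichains P. \<exists>C\<in>antichains P. down P A \<inter> down P B = down P C)"
      by (rule antichain_lattice_iff)
  qed (simp_all add: antichain_meet_eqI antichain_distributive_lattice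
      lower_semilattice.antichain_meet_eq_maximal_elements)
qed

end
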